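(* Let $1\le k\le d\le n-1$ and $1\le\lambda<k$. Consider a distributed storage system $\mathcal{D}(n,k,d)$ equipped with a randomized MBR product-matrix code over $\mathbb{F}_q$ (with $\lambda d-\binom{\lambda}{2}$ of the data units replaced by random units) which is perfectly secure against an adversary of strength at most $\lambda$, and suppose that the $n\times d$ encoding matrix $\Psi$ is a Cauchy matrix. Then for every $\ell$ with $\lambda<\ell<k$ the code is $(k-\ell)$-block secure against an adversary of strength $\ell$.
   Context: $\mathbb{F}_q$ is the finite field with $q$ elements, $[n]=\{1,\dots,n\}$, and $\mathcal{M}=kd-\binom{k}{2}=\binom{k+1}{2}+k(d-k)$. Randomized product-matrix code with threshold $\lambda$: put $R=\lambda d-\binom{\lambda}{2}$ and $\mathcal{M}^{\mathrm s}=\mathcal{M}-R$. Let $X_1,\dots,X_{\mathcal{M}}$ be independent uniformly distributed random variables over $\mathbb{F}_q$; $R$ of them are randomly generated units (not part of the file), and the remaining $\mathcal{M}^{\mathrm s}$ form the file $\boldsymbol{F}=(F_1,\dots,F_{\mathcal{M}^{\mathrm s}})$, whose coordinates are the data units. The message matrix is the $d\times d$ symmetric matrix $$\boldsymbol{M}=\begin{pmatrix}\boldsymbol{S}&\boldsymbol{T}\\ \boldsymbol{T}^{\mathrm t}&\boldsymbol{0}\end{pmatrix},$$ where $\boldsymbol{S}$ is a $k\times k$ symmetric matrix whose $\binom{k+1}{2}$ upper-triangular entries (including the diagonal) are distinct $X_i$'s and $\boldsymbol{T}$ is a $k\times(d-k)$ matrix whose entries are the remaining $k(d-k)$ of the $X_i$'s.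 The encoding matrix is an $n\times d$ matrix $\Psi=[\Phi\ \ \Delta]$ over $\mathbb{F}_q$, with $\Phi$ of size $n\times k$, such that any $d$ rows of $\Psi$ and any $k$ rows of $\Phi$ are linearly independent. Node $i$ stores the $d$ entries of row $i$ of $\Psi\boldsymbol{M}$. Cauchy matrix: a matrix of the form $\big((x_i+y_j)^{-1}\big)$ with $x_i,y_j\in\mathbb{F}_q$, $x_i+y_j\neq0$ for all $i,j$, the $x_i$ pairwise distinct and the $y_j$ pairwise distinct. Let $\boldsymbol{C}^i$ be the random vector stored at Node $i$. The system is perfectly secure against an adversary of strength $\ell$ ($\ell<k$) if the mutual information $\mathsf{I}\big(\boldsymbol{F};(\boldsymbol{C}^i)_{i\in E}\big)=0$ for all $E\subseteq[n]$ with $|E|\le\ell$. It is $b$-block secure against an adversary of strength $\ell$ if $\mathsf{I}\big((F_j)_{j\in B};(\boldsymbol{C}^i)_{i\in E}\big)=0$ for all $B\subseteq[\mathcal{M}^{\mathrm s}]$ with $|B|\le b$ and all $E\subseteq[n]$ with $|E|\le\ell$. *)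

theory Defs
  imports "HOL-Probability.Information" "Jordan_Normal_Form.VS_Connect"
begin

(* Everything is indexed from 0: nodes by {..<n}, the variables X by {..<mbr_size k d},
   and the file coordinates by {..<file_size k d lam}. *)

definition mbr_size :: "nat \<Rightarrow> nat \<Rightarrow> nat" where
  "mbr_size k d = k * d - (k choose 2)"

definition rand_size :: "nat \<Rightarrow> nat \<Rightarrow> nat" where
  "rand_size d lam = lam * d - (lam choose 2)"

definition file_size :: "nat \<Rightarrow> nat \<Rightarrow> nat \<Rightarrow> nat" where
  "file_size k d lam = mbr_size k d - rand_size d lam"

definition iid_uniform :: "'w measure \<Rightarrow> (nat \<Rightarrow> 'w \<Rightarrow> 'a::finite) \<Rightarrow> nat \<Rightarrow> bool" where
  "iid_uniform P X m \<longleftrightarrow>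
     prob_space.indep_vars P (\<lambda>_. count_space UNIV) X {..<m} \<and>
     (\<forall>i<m. distr P (count_space UNIV) (X i) = uniform_count_measure UNIV)"

(* The library's information_space.mutual_information_Pow with base 2; only its vanishing
   is used, which does not depend on the base. *)
definition mutual_info :: "'w measure \<Rightarrow> ('w \<Rightarrow> 'b) \<Rightarrow> ('w \<Rightarrow> 'c) \<Rightarrow> real" where
  "mutual_info P Y Z =
     prob_space.mutual_information P 2 (count_space (Y ` space P)) (count_space (Z ` space P)) Y Z"

definition any_rows_lin_indpt :: "nat \<Rightarrow> 'a::field mat \<Rightarrow> bool" where
  "any_rows_lin_indpt m A \<longleftrightarrow>
     (\<forall>I. I \<subseteq> {..<dim_row A} \<and> card I = m \<longrightarrow>
        inj_on (Matrix.row A) I \<and>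
        \<not> LinearCombinations.module.lin_dep class_ring (module_vec TYPE('a) (dim_col A))
            (Matrix.row A ` I))"

definition cauchy_mat :: "'a::field mat \<Rightarrow> bool" where
  "cauchy_mat A \<longleftrightarrow>
     (\<exists>x y. inj_on x {..<dim_row A} \<and> inj_on y {..<dim_col A} \<and>
        (\<forall>i<dim_row A. \<forall>j<dim_col A. x i + y j \<noteq> 0 \<and> A $$ (i, j) = inverse (x i + y j)))"

(* The positions of the upper triangle of S (b < k) and of T (b \<ge> k) inside the message matrix. *)
definition message_positions :: "nat \<Rightarrow> nat \<Rightarrow> (nat \<times> nat) set" where
  "message_positions k d = {(a, b). a \<le> b \<and> a < k \<and> b < d}"

(* slot (a, b) is the index of the variable placed at position (a, b); x is a realisation
   of the variables. *)
definition message_matrix ::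
    "nat \<Rightarrow> nat \<Rightarrow> (nat \<times> nat \<Rightarrow> nat) \<Rightarrow> (nat \<Rightarrow> 'a::zero) \<Rightarrow> 'a mat" where
  "message_matrix k d slot x =
     (let S = Matrix.mat k k (\<lambda>(a, b). x (slot (min a b, max a b)));
          T = Matrix.mat k (d - k) (\<lambda>(a, b). x (slot (a, k + b)))
      in four_block_mat S T (transpose_mat T) (0\<^sub>m (d - k) (d - k)))"

(* U is the set of indices of the random units. The placement slot, the set U and the
   enumeration phi of the file are arbitrary. *)
definition randomized_mbr_pm_code ::
    "nat \<Rightarrow> nat \<Rightarrow> nat \<Rightarrow> nat \<Rightarrow> 'a::field mat \<Rightarrow> (nat \<times> nat \<Rightarrow> nat) \<Rightarrow>
     nat set \<Rightarrow> (nat \<Rightarrow> nat) \<Rightarrow> bool" where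
  "randomized_mbr_pm_code n k d lam \<Psi> slot U phi \<longleftrightarrow>
     \<Psi> \<in> carrier_mat n d \<and>
     any_rows_lin_indpt d \<Psi> \<and>
     any_rows_lin_indpt k (Matrix.mat n k (\<lambda>(i, j). \<Psi> $$ (i, j))) \<and>
     bij_betw slot (message_positions k d) {..<mbr_size k d} \<and>
     U \<subseteq> {..<mbr_size k d} \<and> card U = rand_size d lam \<and>
     bij_betw phi {..<file_size k d lam} ({..<mbr_size k d} - U)"

definition file_unit :: "(nat \<Rightarrow> nat) \<Rightarrow> (nat \<Rightarrow> 'w \<Rightarrow> 'a) \<Rightarrow> nat \<Rightarrow> 'w \<Rightarrow> 'a" where
  "file_unit phi X j = X (phi j)"

definition node_content ::
    "nat \<Rightarrow> nat \<Rightarrow> 'a::field mat \<Rightarrow> (nat \<times> nat \<Rightarrow> nat) \<Rightarrow> (nat \<Rightarrow> 'w \<Rightarrow> 'a) \<Rightarrow>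
     nat \<Rightarrow> 'w \<Rightarrow> 'a vec" where
  "node_content k d \<Psi> slot X i \<omega> =
     Matrix.row (\<Psi> * message_matrix k d slot (\<lambda>m. X m \<omega>)) i"

definition subfamily :: "(nat \<Rightarrow> 'w \<Rightarrow> 'b) \<Rightarrow> nat set \<Rightarrow> 'w \<Rightarrow> nat \<Rightarrow> 'b" where
  "subfamily Y I \<omega> = (\<lambda>i\<in>I. Y i \<omega>)"

(* A file F with ms coordinates stored, with node contents C, on n nodes. *)
definition perfectly_secure ::
    "'w measure \<Rightarrow> nat \<Rightarrow> nat \<Rightarrow> (nat \<Rightarrow> 'w \<Rightarrow> 'a) \<Rightarrow> (nat \<Rightarrow> 'w \<Rightarrow> 'b) \<Rightarrow> nat \<Rightarrow> bool" where
  "perfectly_secure P n ms F C l \<longleftrightarrow>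
     (\<forall>E. E \<subseteq> {..<n} \<and> card E \<le> l \<longrightarrow>
        mutual_info P (subfamily F {..<ms}) (subfamily C E) = 0)"

definition block_secure ::
    "'w measure \<Rightarrow> nat \<Rightarrow> nat \<Rightarrow> (nat \<Rightarrow> 'w \<Rightarrow> 'a) \<Rightarrow> (nat \<Rightarrow> 'w \<Rightarrow> 'b) \<Rightarrow> nat \<Rightarrow> nat \<Rightarrow> bool" where
  "block_secure P n ms F C b l \<longleftrightarrow>
     (\<forall>B E. B \<subseteq> {..<ms} \<and> card B \<le> b \<and> E \<subseteq> {..<n} \<and> card E \<le> l \<longrightarrow>
        mutual_info P (subfamily F B) (subfamily C E) = 0)"

end

theory Submission
  imports Defs
begin

text \<open>
  Secret and observation are independent as soon as every value of the secret can be produced by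
  a message matrix that the observer sees as zero, because adding such a matrix permutes the
  messages. For a Cauchy matrix, the vectors killed by the rows in E can be given by Lagrange
  interpolation: on any index set J with more than |E| elements there is such a vector with
  support exactly J. If w and z are two of them and w is supported on the first k indices,
  then the matrices w w^t and w z^t + z w^t have the shape of message matrices and are invisible
  to E. Choosing the supports so that they avoid all but one of the k - l positions of the secret
  gives a triangular system, hence all values on these positions.
\<close>

section \<open>Kernel vectors of Cauchy matrices with prescribed support\<close>

text \<open>The polynomial \<open>p\<close> with the roots \<open>x i\<close>, \<open>i\<close> in
  \<open>E\<close>, has degree below \<open>card J\<close>, so it equals its Lagrange interpolant
  \<open>L\<close> at the nodes \<open>- y j\<close>. Evaluating \<open>L\<close> at a root and
  dividing by the product of all \<open>x i + y h\<close> gives the relation, with the interpolation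
  coefficients as \<open>w\<close>. These are nonzero on \<open>J\<close> because no node is a
  root.\<close>

lemma cauchy_kernel:
  fixes x y :: "nat \<Rightarrow> 'a::field"
  assumes "finite E" "finite J" "card E < card J" "inj_on y J"
    and nz: "\<And>i j. i \<in> E \<Longrightarrow> j \<in> J \<Longrightarrow> x i + y j \<noteq> 0"
  shows "\<exists>w. (\<forall>j. w j \<noteq> 0 \<longleftrightarrow> j \<in> J) \<and> (\<forall>i\<in>E. (\<Sum>j\<in>J. inverse (x i + y j) * w j) = 0)"
proof -
  define p where "p = (\<Prod>i\<in>E. [:- x i, 1:])"
  \<comment> \<open>The Lagrange denominator: the basis product over all \<open>h\<close> other than
    \<open>j\<close>, evaluated at the node \<open>- y j\<close>.\<close>
  define D where "D j = (\<Prod>h\<in>J - {j}. y h - y j)" for j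
  define w where "w j = (if j \<in> J then poly p (- y j) / D j else 0)" for j
  define L where "L = (\<Sum>j\<in>J. Polynomial.smult (w j) (\<Prod>h\<in>J - {j}. [:y h, 1:]))"
  have D: "D j \<noteq> 0" if "j \<in> J" for j
    using assms(2,4) that by (auto simp: D_def inj_on_def)
  have p_y: "poly p (- y j) \<noteq> 0" if "j \<in> J" for j
  proof -
    have "poly p (- y j) = (\<Prod>i\<in>E. - (x i + y j))"
      by (simp add: p_def poly_prod)
    then show ?thesis using nz[OF _ that] assms(1) by (simp only: prod_zero_iff neg_equal_0_iff_equal) blast
  qed
  have w: "w j \<noteq> 0 \<longleftrightarrow> j \<in> J" for j
    using D p_y by (auto simp: w_def)
  have deg_p: "degree p < card J"
  proof -
    have "degree p \<le> sum (degree \<circ> (\<lambda>i. [:- x i, 1:])) E"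
      unfolding p_def by (rule degree_prod_sum_le) fact
    then show ?thesis using assms(3) by simp
  qed
  have deg_L: "degree L < card J"
  proof -
    have "degree L \<le> card J - 1" unfolding L_def
    proof (rule degree_sum_le)
      fix j assume j: "j \<in> J"
      have "degree (\<Prod>h\<in>J - {j}. [:y h, 1:]) \<le> sum (degree \<circ> (\<lambda>h. [:y h, 1:])) (J - {j})"
        by (rule degree_prod_sum_le) (use assms(2) in auto)
      also have "\<dots> = card J - 1" using j assms(2) by simp
      finally show "degree (Polynomial.smult (w j) (\<Prod>h\<in>J - {j}. [:y h, 1:])) \<le> card J - 1"
        using degree_smult_le le_trans by blast
    qed fact
    then show ?thesis using assms(3) by linarith
  qed
  have "p = L"
  proof (rule poly_eqI_degree)
    have "card ((\<lambda>j. - y j) ` J) = card J"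
      using assms(4) by (intro card_image) (auto simp: inj_on_def)
    then show "degree p < card ((\<lambda>j. - y j) ` J)" "degree L < card ((\<lambda>j. - y j) ` J)"
      using deg_p deg_L by simp_all
    fix v assume "v \<in> (\<lambda>j. - y j) ` J"
    then obtain j where j: "j \<in> J" and v: "v = - y j" by blast
    have "poly L v = (\<Sum>g\<in>J. w g * (\<Prod>h\<in>J - {g}. y h - y j))"
      by (simp add: L_def poly_sum poly_prod v)
    \<comment> \<open>For \<open>g\<close> other than \<open>j\<close> the product contains the
      factor for \<open>h = j\<close>, which is zero.\<close>
    also have "\<dots> = (\<Sum>g\<in>J. if g = j then w j * D j else 0)"
    proof (rule sum.cong[OF refl])
      fix g assume "g \<in> J"
      show "w g * (\<Prod>h\<in>J - {g}. y h - y j) = (if g = j then w j * D j else 0)"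
        using j assms(2) by (auto simp: D_def)
    qed
    also have "\<dots> = poly p v"
      using j D[OF j] assms(2) by (simp add: w_def v)
    finally show "poly p v = poly L v" ..
  qed
  have "(\<Sum>j\<in>J. inverse (x i + y j) * w j) = 0" if i: "i \<in> E" for i
  proof -
    have "0 = poly p (x i)"
      using i assms(1) by (auto simp: p_def poly_prod)
    also have "\<dots> = (\<Sum>j\<in>J. w j * (\<Prod>h\<in>J - {j}. x i + y h))"
      unfolding \<open>p = L\<close> by (simp add: L_def poly_sum poly_prod add.commute)
    also have "\<dots> = (\<Sum>j\<in>J. (\<Prod>h\<in>J. x i + y h) * (inverse (x i + y j) * w j))"
    proof (rule sum.cong[OF refl])
      fix j assume j: "j \<in> J"
      show "w j * (\<Prod>h\<in>J - {j}. x i + y h) = (\<Prod>h\<in>J. x i + y h) * (inverse (x i + y j) * w j)"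
        using nz[OF i j] by (simp add: prod.remove[OF assms(2) j] field_simps)
    qed
    also have "\<dots> = (\<Prod>h\<in>J. x i + y h) * (\<Sum>j\<in>J. inverse (x i + y j) * w j)"
      by (simp add: sum_distrib_left)
    finally show ?thesis using nz[OF i] assms(2) by auto
  qed
  then show ?thesis using w by blast
qed

section \<open>Invisible message matrices with prescribed entries\<close>

text \<open>Targets are met in order of increasing \<open>r\<close>. The newest position has maximal
  rank, so its element of \<open>V\<close> vanishes at all other positions treated so far, and a
  multiple of it corrects the new value without disturbing theirs. Its values at positions of higher
  rank are harmless, since those are corrected later.\<close>

lemma triangular_interpolation:
  fixes V :: "('i \<Rightarrow> 'a::field) set" and r :: "'i \<Rightarrow> nat"
  assumes "finite B" "(\<lambda>_. 0) \<in> V"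
    and add: "\<And>u v c. u \<in> V \<Longrightarrow> v \<in> V \<Longrightarrow> (\<lambda>i. u i + c * v i) \<in> V"
    and "\<And>p. p \<in> B \<Longrightarrow> \<exists>v\<in>V. v p \<noteq> 0 \<and> (\<forall>p'\<in>B. p' \<noteq> p \<and> r p' \<le> r p \<longrightarrow> v p' = 0)"
  shows "\<exists>v\<in>V. \<forall>p\<in>B. v p = t p"
  using assms(1,4)
proof (induction B rule: finite_ranking_induct[where f = r])
  case empty
  then show ?case using assms(2) by blast
next
  case (insert p B)
  have "\<exists>u\<in>V. \<forall>p\<in>B. u p = t p"
  proof (rule insert.IH)
    fix q assume "q \<in> B"
    then show "\<exists>v\<in>V. v q \<noteq> 0 \<and> (\<forall>p'\<in>B. p' \<noteq> q \<and> r p' \<le> r q \<longrightarrow> v p' = 0)"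
      using insert.prems[of q] by blast
  qed
  then obtain u where u: "u \<in> V" "\<forall>p\<in>B. u p = t p" by blast
  obtain v where v: "v \<in> V" "v p \<noteq> 0" "\<forall>p'\<in>B. p' \<noteq> p \<longrightarrow> v p' = 0"
  proof -
    obtain v where "v \<in> V" "v p \<noteq> 0" "\<forall>p'\<in>insert p B. p' \<noteq> p \<and> r p' \<le> r p \<longrightarrow> v p' = 0"
      using insert.prems[of p] by blast
    then show thesis using insert.hyps(2) by (intro that) blast+
  qed
  have "(\<lambda>i. u i + ((t p - u p) / v p) * v i) \<in> V"
    by (rule add) fact+
  moreover have "\<forall>p'\<in>insert p B. u p' + ((t p - u p) / v p) * v p' = t p'"
  proof
    fix p' assume "p' \<in> insert p B"
    then show "u p' + ((t p - u p) / v p) * v p' = t p'"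
      using u(2) v(2,3) by (cases "p' = p") simp_all
  qed
  ultimately show ?case
    by (intro bexI[where x = "\<lambda>i. u i + ((t p - u p) / v p) * v i"])
qed

text \<open>The entries of a message matrix filled by \<open>v\<close>, indexed by positions instead
  of variable numbers. As a plain function it is linear in \<open>v\<close> and can be summed
  without dimension side conditions.\<close>

definition sym_ext :: "nat \<Rightarrow> (nat \<times> nat \<Rightarrow> 'a::zero) \<Rightarrow> nat \<Rightarrow> nat \<Rightarrow> 'a" where
  "sym_ext k v a b = (if min a b < k then v (min a b, max a b) else 0)"

text \<open>Each position of \<open>B\<close> other than a given \<open>p\<close> excludes at most
  one index, so more than \<open>card E\<close> indices below \<open>k\<close> remain to support a
  kernel vector that is nonzero where \<open>p\<close> needs it. Products of such vectors separate
  the positions in the triangular sense of \<open>r\<close>.\<close>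

lemma sym_ext_interpolation:
  fixes x y :: "nat \<Rightarrow> 'a::field"
  assumes "inj_on y {..<d}" and nz: "\<And>i j. i \<in> E \<Longrightarrow> j < d \<Longrightarrow> x i + y j \<noteq> 0"
    and "finite E" "k \<le> d" "B \<subseteq> message_positions k d" "card B + card E \<le> k"
  shows "\<exists>v. (\<forall>p\<in>B. v p = t p) \<and>
    (\<forall>i\<in>E. \<forall>b<d. (\<Sum>a<d. inverse (x i + y a) * sym_ext k v a b) = 0)"
proof -
  define V where
    "V = {v. \<forall>i\<in>E. \<forall>b<d. (\<Sum>a<d. inverse (x i + y a) * sym_ext k v a b) = 0}"
  define K where "K = {w. \<forall>i\<in>E. (\<Sum>a<d. inverse (x i + y a) * w a) = 0}"
  \<comment> \<open>The matrix attached to a position will vanish at all other positions of at most its rank; only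
    for the diagonal entries of S can its support avoid every other position.\<close>
  define r :: "nat \<times> nat \<Rightarrow> nat" where
    "r p = (if fst p = snd p then 2 else if snd p < k then 1 else 0)" for p
  have K: "\<exists>w\<in>K. \<forall>j. w j \<noteq> 0 \<longleftrightarrow> j \<in> J" if J: "J \<subseteq> {..<d}" "card E < card J" for J
  proof -
    have "\<exists>w. (\<forall>j. w j \<noteq> 0 \<longleftrightarrow> j \<in> J) \<and> (\<forall>i\<in>E. (\<Sum>j\<in>J. inverse (x i + y j) * w j) = 0)"
      using J assms(1) nz finite_subset[OF J(1)]
      by (intro cauchy_kernel \<open>finite E\<close>) (auto intro: inj_on_subset)
    then obtain w where w: "\<And>j. w j \<noteq> 0 \<longleftrightarrow> j \<in> J"
      "\<And>i. i \<in> E \<Longrightarrow> (\<Sum>j\<in>J. inverse (x i + y j) * w j) = 0" by blast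
    have "(\<Sum>j<d. inverse (x i + y j) * w j) = (\<Sum>j\<in>J. inverse (x i + y j) * w j)" for i
      using J(1) w(1) by (intro sum.mono_neutral_right) auto
    then show ?thesis using w unfolding K_def by (intro bexI[of _ w]) auto
  qed
  have finB: "finite B"
    by (rule finite_subset[OF assms(5)], rule finite_subset[of _ "{..<k} \<times> {..<d}"])
      (auto simp: message_positions_def)
  \<comment> \<open>Column \<open>b\<close> is a multiple of \<open>w\<close>, hence killed; the
    support of \<open>w\<close> below \<open>k\<close> provides the zero block.\<close>
  have S: "(\<lambda>(a, b). w a * w b) \<in> V" if "w \<in> K" "\<forall>j\<ge>k. w j = 0" for w
  proof -
    have "sym_ext k (\<lambda>(a, b). w a * w b) a b = w a * w b" for a b
      using that(2) by (auto simp: sym_ext_def min_def max_def)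
    then show ?thesis using that(1)
      by (simp add: V_def K_def mult.assoc[symmetric] sum_distrib_right[symmetric])
  qed
  \<comment> \<open>For the zero block it is enough that one factor is supported below
    \<open>k\<close>, so \<open>z\<close> may reach into the columns of T.\<close>
  have T: "(\<lambda>(a, b). w a * z b + z a * w b) \<in> V"
    if "w \<in> K" "z \<in> K" "\<forall>j\<ge>k. w j = 0" for w z
  proof -
    have "sym_ext k (\<lambda>(a, b). w a * z b + z a * w b) a b = w a * z b + z a * w b" for a b
      using that(3) by (auto simp: sym_ext_def min_def max_def algebra_simps)
    then show ?thesis using that(1,2)
      by (simp add: V_def K_def distrib_left sum.distrib mult.assoc[symmetric]
          sum_distrib_right[symmetric])
  qed
  \<comment> \<open>\<open>H\<close> has at most \<open>card B - 1\<close> elements, so at least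
    \<open>k - card B + 1 > card E\<close> indices remain. The map \<open>f\<close> stays free
    because the two cases below exclude different indices.\<close>
  have J: "{..<k} - H \<subseteq> {..<d}" "card E < card ({..<k} - H)"
    if "p \<in> B" "H \<subseteq> f ` (B - {p})" for H p and f :: "nat \<times> nat \<Rightarrow> nat"
  proof -
    have "finite H" using that(2) finB finite_subset by blast
    have "card H \<le> card (B - {p})"
      using that(2) finB by (meson card_image_le card_mono finite_Diff finite_imageI le_trans)
    also have "\<dots> < card B" by (rule card_Diff1_less[OF finB that(1)])
    finally show "card E < card ({..<k} - H)"
      using diff_card_le_card_Diff[OF \<open>finite H\<close>, of "{..<k}"] assms(6) by simp
  qed (use assms(4) in auto)
  have "\<exists>v\<in>V. v p \<noteq> 0 \<and> (\<forall>p'\<in>B. p' \<noteq> p \<and> r p' \<le> r p \<longrightarrow> v p' = 0)" if p: "p \<in> B" for p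
  proof -
    obtain a b where ab: "p = (a, b)" "a \<le> b" "a < k" "b < d"
      using p assms(5) by (auto simp: message_positions_def)
    show ?thesis
    proof (cases "b < k")
      case True
      \<comment> \<open>The product \<open>w w^t\<close> vanishes at \<open>p'\<close> once
        \<open>w\<close> vanishes at one of its two indices; \<open>f\<close> picks one outside
        \<open>{a, b}\<close> where possible, since \<open>w\<close> must not vanish at
        \<open>a\<close> and \<open>b\<close>.\<close>
      define f where "f p' = (if fst p' \<in> {a, b} then snd p' else fst p')" for p' :: "nat \<times> nat"
      define H where "H = f ` (B - {p}) - {a, b}"
      obtain w where w: "w \<in> K" "\<And>j. w j \<noteq> 0 \<longleftrightarrow> j \<in> {..<k} - H"
        using K[OF J[OF p, of H f]] H_def by blast
      have wk: "\<forall>j\<ge>k. w j = 0" by (metis w(2) DiffD1 lessThan_iff not_le)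
      have "w a * w b \<noteq> 0" using w(2) ab True by (simp add: H_def)
      moreover have "w (fst p') * w (snd p') = 0"
        if "p' \<in> B" "p' \<noteq> p" "r p' \<le> r p" for p'
      proof -
        \<comment> \<open>Only \<open>(a, a)\<close> and \<open>(b, b)\<close> could violate this
          besides \<open>p\<close>. If \<open>a < b\<close>, they have rank 2 while \<open>p\<close>
          has rank 1; if \<open>a = b\<close>, they are \<open>p\<close> itself.\<close>
        have "f p' \<notin> {a, b}"
          using that ab True assms(5)
          by (auto simp: f_def r_def message_positions_def split: if_splits)
        then have "f p' \<in> H" using that by (auto simp: H_def)
        then have "w (f p') = 0" using w(2) by blast
        then show ?thesis by (auto simp: f_def split: if_splits)
      qed
      ultimately show ?thesis
        by (intro bexI[OF _ S[OF w(1) wk]]) (simp add: split_beta ab(1))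
    next
      case False
      define H where "H = fst ` (B - {p}) - {a}"
      obtain w where w: "w \<in> K" "\<And>j. w j \<noteq> 0 \<longleftrightarrow> j \<in> {..<k} - H"
        using K[OF J[OF p, of H fst]] H_def by blast
      \<comment> \<open>Among the indices from \<open>k\<close> on, the support of \<open>z\<close>
        contains only \<open>b\<close>, which singles out column \<open>b\<close> of T; together
        with all indices below \<open>k\<close> it is large enough for \<open>K\<close>.\<close>
      obtain z where z: "z \<in> K" "\<And>j. z j \<noteq> 0 \<longleftrightarrow> j \<in> insert b {..<k}"
        using K[of "insert b {..<k}"] ab False assms(4,6) by auto
      have wk: "\<forall>j\<ge>k. w j = 0" by (metis w(2) DiffD1 lessThan_iff not_le)
      have "w a * z b + z a * w b \<noteq> 0"
        using w(2)[of a] z(2)[of b] wk ab False by (simp add: H_def)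
      moreover have "w (fst p') * z (snd p') + z (fst p') * w (snd p') = 0"
        if "p' \<in> B" "p' \<noteq> p" "r p' \<le> r p" for p'
      proof -
        \<comment> \<open>Here \<open>p\<close> has rank 0, so only positions in T compete. There
          the second summand vanishes with \<open>w (snd p')\<close>; the first is killed by
          \<open>z\<close> in row \<open>a\<close> and by \<open>w\<close> in the other
          rows.\<close>
        have "snd p' \<ge> k"
          using that(3) ab False by (auto simp: r_def split: if_splits)
        moreover have "w (fst p') = 0 \<or> z (snd p') = 0"
        proof (cases "fst p' = a")
          case True
          then have "snd p' \<noteq> b" using that(2) ab(1) by (cases p') auto
          then show ?thesis using z(2) \<open>snd p' \<ge> k\<close> by auto
        next
          case False
          then have "fst p' \<in> H" using that by (auto simp: H_def)
          then show ?thesis using w(2) by blast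
        qed
        ultimately show ?thesis using wk by auto
      qed
      ultimately show ?thesis
        by (intro bexI[OF _ T[OF w(1) z(1) wk]]) (simp add: split_beta ab(1))
    qed
  qed
  moreover have "(\<lambda>_. 0) \<in> V" by (simp add: V_def sym_ext_def)
  moreover have "(\<lambda>p. u p + c * v p) \<in> V" if uv: "u \<in> V" "v \<in> V" for u v c
  proof -
    have "sym_ext k (\<lambda>p. u p + c * v p) a b = sym_ext k u a b + c * sym_ext k v a b" for a b
      by (simp add: sym_ext_def)
    then show ?thesis using uv
      by (simp add: V_def distrib_left sum.distrib mult.left_commute[of _ c]
          sum_distrib_left[symmetric])
  qed
  ultimately have "\<exists>v\<in>V. \<forall>p\<in>B. v p = t p"
    by (intro triangular_interpolation[where r = r] finB)
  then show ?thesis by (auto simp: V_def)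
qed

section \<open>Message matrix and node contents in coordinates\<close>

lemma message_matrix_carrier: "k \<le> d \<Longrightarrow> message_matrix k d slot x \<in> carrier_mat d d"
  using four_block_carrier_mat[of "Matrix.mat k k (\<lambda>(a, b). x (slot (min a b, max a b)))" k k
      "0\<^sub>m (d - k) (d - k)" "d - k" "d - k"]
  by (simp add: message_matrix_def Let_def)

lemma message_matrix_index:
  assumes "k \<le> d" "a < d" "b < d"
  shows "message_matrix k d slot x $$ (a, b) = sym_ext k (\<lambda>p. x (slot p)) a b"
  using assms by (auto simp: message_matrix_def Let_def sym_ext_def min_def max_def)

lemma node_content_eq:
  assumes "k \<le> d" "\<Psi> \<in> carrier_mat n d" "i < n"
  shows "node_content k d \<Psi> slot X i \<omega> =
    Matrix.vec d (\<lambda>b. \<Sum>a<d. \<Psi> $$ (i, a) * sym_ext k (\<lambda>p. X (slot p) \<omega>) a b)"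
proof -
  have "Matrix.row (\<Psi> * message_matrix k d slot (\<lambda>m. X m \<omega>)) i $ b =
      (\<Sum>a<d. \<Psi> $$ (i, a) * sym_ext k (\<lambda>p. X (slot p) \<omega>) a b)" if "b < d" for b
    using assms message_matrix_carrier[OF assms(1), of slot "\<lambda>m. X m \<omega>"] that
    by (auto simp: scalar_prod_def lessThan_atLeast0 message_matrix_index intro!: sum.cong)
  then show ?thesis
    using assms message_matrix_carrier[OF assms(1), of slot "\<lambda>m. X m \<omega>"]
    unfolding node_content_def by (intro eq_vecI) auto
qed

section \<open>From uniform variables to vanishing mutual information by counting\<close>

text \<open>Independence gives every single tuple the probability \<open>1 / CARD('a) ^ m\<close>,
  and the events of distinct tuples are disjoint. This reduces the later probabilities to
  cardinalities.\<close>

lemma iid_uniform_joint: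
  fixes X :: "nat \<Rightarrow> 'w \<Rightarrow> 'a::finite"
  assumes "prob_space P" "iid_uniform P X m" "0 < m" "A \<subseteq> PiE {..<m} (\<lambda>_. UNIV)"
  shows "{\<omega> \<in> space P. (\<lambda>i\<in>{..<m}. X i \<omega>) \<in> A} \<in> sets P"
    and "measure P {\<omega> \<in> space P. (\<lambda>i\<in>{..<m}. X i \<omega>) \<in> A} = card A / CARD('a) ^ m"
proof -
  interpret prob_space P by fact
  have ind: "indep_vars (\<lambda>_. count_space UNIV) X {..<m}"
    and unif: "\<And>i. i < m \<Longrightarrow> distr P (count_space UNIV) (X i) = uniform_count_measure UNIV"
    using assms(2) by (auto simp: iid_uniform_def)
  have meas: "X i \<in> measurable P (count_space UNIV)" if "i < m" for i
    using ind that by (auto simp: indep_vars_def)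
  \<comment> \<open>For \<open>m = 0\<close> this intersection would be \<open>UNIV\<close> rather
    than \<open>space P\<close>, hence the hypothesis \<open>0 < m\<close>.\<close>
  define ev where "ev z = (\<Inter>i\<in>{..<m}. X i -` {z i} \<inter> space P)" for z
  have ev: "ev z \<in> sets P" for z
    unfolding ev_def using assms(3) meas by (intro sets.finite_INT) (auto intro: measurable_sets)
  have p1: "prob (X i -` {c} \<inter> space P) = 1 / CARD('a)" if "i < m" for i c
  proof -
    have "prob (X i -` {c} \<inter> space P) = measure (distr P (count_space UNIV) (X i)) {c}"
      using meas[OF that] by (simp add: measure_distr)
    also have "\<dots> = 1 / CARD('a)"
      by (simp add: unif[OF that] measure_uniform_count_measure)
    finally show ?thesis .
  qed
  have pev: "prob (ev z) = 1 / CARD('a) ^ m" for z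
    unfolding ev_def using assms(3) p1
    by (subst indep_varsD_finite[OF ind]) (auto simp: power_one_over)
  have finA: "finite A" using assms(4) by (rule finite_subset) (auto intro: finite_PiE)
  have eq: "{\<omega> \<in> space P. (\<lambda>i\<in>{..<m}. X i \<omega>) \<in> A} = (\<Union>z\<in>A. ev z)"
  proof (intro Set.set_eqI iffI)
    fix \<omega> assume "\<omega> \<in> {\<omega> \<in> space P. (\<lambda>i\<in>{..<m}. X i \<omega>) \<in> A}"
    then show "\<omega> \<in> (\<Union>z\<in>A. ev z)"
      by (intro UN_I[of "\<lambda>i\<in>{..<m}. X i \<omega>"]) (auto simp: ev_def)
  next
    fix \<omega> assume "\<omega> \<in> (\<Union>z\<in>A. ev z)"
    then obtain z where z: "z \<in> A" "\<omega> \<in> ev z" by blast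
    then have "z \<in> PiE {..<m} (\<lambda>_. UNIV)" "\<And>i. i < m \<Longrightarrow> X i \<omega> = z i"
      using assms(3,4) by (auto simp: ev_def split: if_splits)
    then have "(\<lambda>i\<in>{..<m}. X i \<omega>) = z"
      by (intro PiE_ext[of _ "{..<m}" "\<lambda>_. UNIV"]) auto
    then show "\<omega> \<in> {\<omega> \<in> space P. (\<lambda>i\<in>{..<m}. X i \<omega>) \<in> A}"
      using z assms(3) by (auto simp: ev_def split: if_splits)
  qed
  show "{\<omega> \<in> space P. (\<lambda>i\<in>{..<m}. X i \<omega>) \<in> A} \<in> sets P"
    unfolding eq using finA ev by (intro sets.finite_UN) auto
  have "disjoint_family_on ev A"
    unfolding disjoint_family_on_def
  proof (intro ballI impI)
    fix z z' assume z: "z \<in> A" "z' \<in> A" "z \<noteq> z'"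
    have "\<exists>i<m. z i \<noteq> z' i"
    proof (rule ccontr)
      assume "\<not> (\<exists>i<m. z i \<noteq> z' i)"
      then have "z = z'"
        using z(1,2) assms(4) by (intro PiE_ext[of z "{..<m}" "\<lambda>_. UNIV"]) auto
      then show False using z(3) by contradiction
    qed
    then show "ev z \<inter> ev z' = {}" by (auto simp: ev_def)
  qed
  then show "measure P {\<omega> \<in> space P. (\<lambda>i\<in>{..<m}. X i \<omega>) \<in> A} = card A / CARD('a) ^ m"
    unfolding eq using finA ev by (subst finite_measure_finite_Union) (auto simp: pev)
qed

text \<open>Translation by an \<open>s\<close> with values \<open>v j - u j\<close> at
  \<open>phi j\<close> maps the fibre over \<open>u\<close> injectively into the fibre over
  \<open>v\<close>. By symmetry all \<open>CARD('a) ^ card B\<close> fibres have the same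
  size.\<close>

lemma card_fibre_shift:
  fixes S :: "(nat \<Rightarrow> 'a::{ab_group_add, finite}) set"
  assumes S: "S \<subseteq> PiE {..<m} (\<lambda>_. UNIV)"
    and phi: "phi ` B \<subseteq> {..<m}" "finite B"
    and shift: "\<And>t. \<exists>s. (\<forall>j\<in>B. s (phi j) = t j) \<and> (\<forall>x\<in>S. (\<lambda>i\<in>{..<m}. x i + s i) \<in> S)"
    and t: "t \<in> PiE B (\<lambda>_. UNIV)"
  shows "card S = CARD('a) ^ card B * card {x \<in> S. (\<lambda>j\<in>B. x (phi j)) = t}"
proof -
  define F where "F u = {x \<in> S. (\<lambda>j\<in>B. x (phi j)) = u}" for u
  have finS: "finite S" using S by (rule finite_subset) (auto intro: finite_PiE)
  have le: "card (F u) \<le> card (F v)"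
    if uv: "u \<in> PiE B (\<lambda>_. UNIV)" "v \<in> PiE B (\<lambda>_. UNIV)" for u v
  proof -
    obtain s where s: "\<And>j. j \<in> B \<Longrightarrow> s (phi j) = v j - u j"
      "\<And>x. x \<in> S \<Longrightarrow> (\<lambda>i\<in>{..<m}. x i + s i) \<in> S"
      using shift[of "\<lambda>j. v j - u j"] by blast
    show ?thesis
    proof (rule card_inj_on_le[where f = "\<lambda>x. \<lambda>i\<in>{..<m}. x i + s i"])
      show "inj_on (\<lambda>x. \<lambda>i\<in>{..<m}. x i + s i) (F u)"
      proof (rule inj_onI)
        fix x x' assume x: "x \<in> F u" "x' \<in> F u"
          "(\<lambda>i\<in>{..<m}. x i + s i) = (\<lambda>i\<in>{..<m}. x' i + s i)"
        have "x i = x' i" if "i < m" for i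
          using fun_cong[OF x(3), of i] that by simp
        moreover have "x \<in> PiE {..<m} (\<lambda>_. UNIV)" "x' \<in> PiE {..<m} (\<lambda>_. UNIV)"
          using x S by (auto simp: F_def)
        ultimately show "x = x'" by (intro PiE_ext) auto
      qed
      show "(\<lambda>x. \<lambda>i\<in>{..<m}. x i + s i) ` F u \<subseteq> F v"
      proof clarify
        fix x assume x: "x \<in> F u"
        then have "x (phi j) = u j" if "j \<in> B" for j
          using that by (auto simp: F_def)
        then have "(\<lambda>j\<in>B. (\<lambda>i\<in>{..<m}. x i + s i) (phi j)) = v"
          using phi s(1) uv(2) by (intro ext) (auto simp: PiE_def extensional_def restrict_def)
        then show "(\<lambda>i\<in>{..<m}. x i + s i) \<in> F v" using x s(2) by (auto simp: F_def)
      qed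
      show "finite (F v)" using finS by (simp add: F_def)
    qed
  qed
  have "S = (\<Union>u\<in>PiE B (\<lambda>_. UNIV). F u)" by (auto simp: F_def)
  moreover have "card (\<Union>u\<in>PiE B (\<lambda>_. UNIV). F u) = (\<Sum>u\<in>PiE B (\<lambda>_. UNIV). card (F u))"
    using finS phi(2) by (intro card_UN_disjoint) (auto simp: F_def intro!: finite_PiE)
  ultimately have "card S = (\<Sum>u\<in>PiE B (\<lambda>_. UNIV). card (F u))" by metis
  also have "\<dots> = (\<Sum>u\<in>PiE B (\<lambda>_. UNIV :: 'a set). card (F t))"
    using le t by (intro sum.cong) (auto intro: antisym)
  finally show ?thesis using phi(2) by (simp add: F_def card_PiE)
qed

text \<open>Translations that leave \<open>c\<close> unchanged move the secret to any value, so the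
  secret is equidistributed on each fibre of \<open>c\<close> just as on the whole space. Hence the
  joint law is the product of the marginals.\<close>

lemma mutual_info_eq_0_shift:
  fixes X :: "nat \<Rightarrow> 'w \<Rightarrow> 'a::{ab_group_add, finite}" and c :: "(nat \<Rightarrow> 'a) \<Rightarrow> 'c"
  assumes P: "prob_space P" "iid_uniform P X m" "0 < m"
    and phi: "phi ` B \<subseteq> {..<m}" "finite B"
    and local: "\<And>x. c (\<lambda>i\<in>{..<m}. x i) = c x"
    and shift: "\<And>t. \<exists>s. (\<forall>j\<in>B. s (phi j) = t j) \<and> (\<forall>x. c (\<lambda>i. x i + s i) = c x)"
  shows "mutual_info P (\<lambda>\<omega>. \<lambda>j\<in>B. X (phi j) \<omega>) (\<lambda>\<omega>. c (\<lambda>i. X i \<omega>)) = 0"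
proof -
  interpret prob_space P by fact
  define G where "G = PiE {..<m} (\<lambda>_. UNIV :: 'a set)"
  define f where "f x = (\<lambda>j\<in>B. x (phi j))" for x :: "nat \<Rightarrow> 'a"
  define Z where "Z \<omega> = (\<lambda>i\<in>{..<m}. X i \<omega>)" for \<omega>
  define Y1 where "Y1 \<omega> = (\<lambda>j\<in>B. X (phi j) \<omega>)" for \<omega>
  define Y2 where "Y2 \<omega> = c (\<lambda>i. X i \<omega>)" for \<omega>
  define S1 where "S1 = Y1 ` space P"
  define S2 where "S2 = Y2 ` space P"
  have Z: "Z \<omega> \<in> G" for \<omega> by (auto simp: Z_def G_def)
  have finG: "finite G" unfolding G_def by (auto intro: finite_PiE)
  have Y1: "Y1 \<omega> = f (Z \<omega>)" for \<omega>
    using phi(1) unfolding Y1_def f_def Z_def by (intro restrict_ext) auto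
  have Y2: "Y2 \<omega> = c (Z \<omega>)" for \<omega>
    by (simp add: Y2_def Z_def local)
  have S1: "S1 \<subseteq> f ` G" and S2: "S2 \<subseteq> c ` G"
    using Z by (auto simp: S1_def S2_def Y1 Y2)
  have fin: "finite S1" "finite S2"
    using S1 S2 finG by (meson finite_imageI finite_subset)+
  have pr: "{\<omega> \<in> space P. Q (Z \<omega>)} \<in> sets P"
    "prob {\<omega> \<in> space P. Q (Z \<omega>)} = card {x \<in> G. Q x} / CARD('a) ^ m" for Q
    using iid_uniform_joint[OF P, of "{x \<in> G. Q x}"] Z
    by (auto simp: G_def Z_def[symmetric])
  have m1: "Y1 \<in> measurable P (count_space S1)" and m2: "Y2 \<in> measurable P (count_space S2)"
  proof -
    have "Y1 -` {t} \<inter> space P = {\<omega> \<in> space P. f (Z \<omega>) = t}"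
      "Y2 -` {u} \<inter> space P = {\<omega> \<in> space P. c (Z \<omega>) = u}" for t u
      by (auto simp: Y1 Y2)
    moreover have "{\<omega> \<in> space P. f (Z \<omega>) = t} \<in> events"
      "{\<omega> \<in> space P. c (Z \<omega>) = u} \<in> events" for t u
      by (rule pr(1))+
    ultimately show "Y1 \<in> measurable P (count_space S1)" "Y2 \<in> measurable P (count_space S2)"
      unfolding measurable_count_space_eq2[OF fin(1)] measurable_count_space_eq2[OF fin(2)]
      by (auto simp: S1_def S2_def)
  qed
  \<comment> \<open>Independence without division: \<open>card_fibre_shift\<close> is applied to
    \<open>G\<close> and to the fibre of \<open>c\<close> over \<open>u\<close>, and the factor
    \<open>CARD('a) ^ card B\<close> is common to both.\<close>
  have count: "card {x \<in> G. f x = t} * card {x \<in> G. c x = u} =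
      card {x \<in> G. f x = t \<and> c x = u} * card G" if "t \<in> S1" for t u
  proof -
    have t: "t \<in> PiE B (\<lambda>_. UNIV)" using that S1 by (auto simp: f_def)
    have c_shift: "c (\<lambda>i\<in>{..<m}. x i + s i) = c (\<lambda>i. x i + s i)" for x s
      using local[of "\<lambda>i. x i + s i"] .
    have 1: "card G = CARD('a) ^ card B * card {x \<in> G. f x = t}"
      unfolding f_def
    proof (rule card_fibre_shift[OF _ phi _ t])
      fix t' :: "'b \<Rightarrow> 'a"
      obtain s where "\<forall>j\<in>B. s (phi j) = t' j" using shift[of t'] by blast
      then show "\<exists>s. (\<forall>j\<in>B. s (phi j) = t' j) \<and> (\<forall>x\<in>G. (\<lambda>i\<in>{..<m}. x i + s i) \<in> G)"
        by (intro exI[of _ s]) (auto simp: G_def)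
    qed (simp add: G_def)
    have "card {x \<in> G. c x = u} =
        CARD('a) ^ card B * card {x \<in> {x \<in> G. c x = u}. f x = t}"
      unfolding f_def
    proof (rule card_fibre_shift[OF _ phi _ t])
      fix t' :: "'b \<Rightarrow> 'a"
      obtain s where "\<forall>j\<in>B. s (phi j) = t' j" "\<forall>x. c (\<lambda>i. x i + s i) = c x"
        using shift[of t'] by blast
      then show "\<exists>s. (\<forall>j\<in>B. s (phi j) = t' j) \<and>
          (\<forall>x\<in>{x \<in> G. c x = u}. (\<lambda>i\<in>{..<m}. x i + s i) \<in> {x \<in> G. c x = u})"
        by (intro exI[of _ s]) (auto simp: c_shift G_def)
    qed (auto simp: G_def)
    moreover have "{x \<in> {x \<in> G. c x = u}. f x = t} = {x \<in> G. f x = t \<and> c x = u}" by auto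
    ultimately show ?thesis using 1 by simp
  qed
  have cardG: "card G = CARD('a) ^ m" by (simp add: G_def card_PiE)
  have joint: "distr P (count_space S1) Y1 \<Otimes>\<^sub>M distr P (count_space S2) Y2 =
      distr P (count_space S1 \<Otimes>\<^sub>M count_space S2) (\<lambda>\<omega>. (Y1 \<omega>, Y2 \<omega>))"
    (is "?L = ?R")
  proof (rule measure_eqI_finite)
    interpret D2: prob_space "distr P (count_space S2) Y2" using m2 by (rule prob_space_distr)
    have eqc: "count_space S1 \<Otimes>\<^sub>M count_space S2 = count_space (S1 \<times> S2)"
      by (rule pair_measure_count_space) fact+
    show "finite (S1 \<times> S2)" using fin by simp
    show "sets ?R = Pow (S1 \<times> S2)" by (simp add: eqc)
    have "sets ?L = sets (count_space S1 \<Otimes>\<^sub>M count_space S2)"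
      by (intro sets_pair_measure_cong) simp_all
    then show "sets ?L = Pow (S1 \<times> S2)" unfolding eqc by simp
    fix p assume "p \<in> S1 \<times> S2"
    then obtain t u where tu: "p = (t, u)" "t \<in> S1" "u \<in> S2" by auto
    have "emeasure ?L {p} = emeasure ?L ({t} \<times> {u})" by (simp add: tu)
    also have "\<dots> = emeasure (distr P (count_space S1) Y1) {t} *
        emeasure (distr P (count_space S2) Y2) {u}"
      using tu by (intro D2.emeasure_pair_measure_Times) auto
    also have "\<dots> = ennreal (prob {\<omega> \<in> space P. f (Z \<omega>) = t}) *
        ennreal (prob {\<omega> \<in> space P. c (Z \<omega>) = u})"
      using tu m1 m2
      by (simp add: emeasure_distr emeasure_eq_measure Y1[symmetric] Y2[symmetric]
          vimage_def Int_def conj_commute)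
    also have "\<dots> = ennreal (prob {\<omega> \<in> space P. f (Z \<omega>) = t \<and> c (Z \<omega>) = u})"
    proof -
      have "real (card {x \<in> G. f x = t}) * real (card {x \<in> G. c x = u}) =
          real (card {x \<in> G. f x = t \<and> c x = u}) * real (CARD('a) ^ m)"
        by (simp only: of_nat_mult[symmetric] count[OF tu(2), of u] cardG)
      then show ?thesis
        unfolding pr(2)[of "\<lambda>x. f x = t"] pr(2)[of "\<lambda>x. c x = u"]
          pr(2)[of "\<lambda>x. f x = t \<and> c x = u"]
        by (simp add: ennreal_mult[symmetric] field_simps)
    qed
    also have "\<dots> = emeasure ?R {p}"
    proof -
      have "(\<lambda>\<omega>. (Y1 \<omega>, Y2 \<omega>)) \<in> measurable P (count_space S1 \<Otimes>\<^sub>M count_space S2)"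
        using m1 m2 by simp
      then show ?thesis
        using tu by (simp add: emeasure_distr emeasure_eq_measure Y1[symmetric] Y2[symmetric]
            vimage_def Int_def conj_commute eqc)
    qed
    finally show "emeasure ?L {p} = emeasure ?R {p}" .
  qed
  interpret J: prob_space "distr P (count_space S1 \<Otimes>\<^sub>M count_space S2) (\<lambda>\<omega>. (Y1 \<omega>, Y2 \<omega>))"
    using m1 m2 by (intro prob_space_distr) simp
  \<comment> \<open>Mutual information is the divergence between the product law and the joint law,
    which coincide by \<open>joint\<close>.\<close>
  have "mutual_information 2 (count_space S1) (count_space S2) Y1 Y2 = 0"
    unfolding mutual_information_def
    by (simp add: joint J.KL_same_eq_0)
  then show ?thesis
    unfolding mutual_info_def S1_def S2_def Y1_def[abs_def] Y2_def[abs_def] .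
qed

section \<open>Block security from invisible shifts of the message\<close>

theorem mainTheorem4:
  fixes P :: "'w measure"
    and X :: "nat \<Rightarrow> 'w \<Rightarrow> 'a :: {field, finite}"
    and \<Psi> :: "'a mat"
    and n k d lam l :: nat
    and slot :: "nat \<times> nat \<Rightarrow> nat"
    and U :: "nat set"
    and phi :: "nat \<Rightarrow> nat"
  assumes "1 \<le> k" and "k \<le> d" and "d + 1 \<le> n"
    and "1 \<le> lam" and "lam < k"
    and "prob_space P"
    and "iid_uniform P X (mbr_size k d)"
    and "randomized_mbr_pm_code n k d lam \<Psi> slot U phi"
    and "perfectly_secure P n (file_size k d lam)
           (file_unit phi X) (node_content k d \<Psi> slot X) lam"
    and "cauchy_mat \<Psi>"
    and "lam < l" and "l < k"
  shows "block_secure P n (file_size k d lam)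
           (file_unit phi X) (node_content k d \<Psi> slot X) (k - l) l"
proof -
  have \<Psi>: "\<Psi> \<in> carrier_mat n d"
    and slot: "bij_betw slot (message_positions k d) {..<mbr_size k d}"
    and phi: "bij_betw phi {..<file_size k d lam} ({..<mbr_size k d} - U)"
    using assms(8) by (auto simp: randomized_mbr_pm_code_def)
  obtain x y where y: "inj_on y {..<d}"
    and nz: "\<And>i j. i < n \<Longrightarrow> j < d \<Longrightarrow> x i + y j \<noteq> 0"
    and \<Psi>_eq: "\<And>i j. i < n \<Longrightarrow> j < d \<Longrightarrow> \<Psi> $$ (i, j) = inverse (x i + y j)"
    using assms(10) \<Psi> by (auto simp: cauchy_mat_def)
  have slot_lt: "slot p < mbr_size k d" if "p \<in> message_positions k d" for p
    using bij_betwE[OF slot] that by auto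
  have "(0, 0) \<in> message_positions k d"
    using assms(1,2) by (simp add: message_positions_def)
  then have mpos: "0 < mbr_size k d" using slot_lt by fastforce
  show ?thesis
    unfolding block_secure_def
  proof (intro allI impI, elim conjE)
    fix B E
    assume B: "B \<subseteq> {..<file_size k d lam}" "card B \<le> k - l"
      and E: "E \<subseteq> {..<n}" "card E \<le> l"
    define c where "c z = (\<lambda>i\<in>E. Matrix.vec d (\<lambda>b. \<Sum>a<d.
        \<Psi> $$ (i, a) * sym_ext k (\<lambda>p. z (slot p)) a b))" for z
    have fin: "finite B" "finite E" using B(1) E(1) finite_subset by blast+
    have phiB: "phi ` B \<subseteq> {..<mbr_size k d}"
      using bij_betw_imp_surj_on[OF phi] B(1) by blast
    have inj: "inj_on phi B" using phi B(1) by (auto simp: bij_betw_def intro: inj_on_subset)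
    define pos where "pos j = inv_into (message_positions k d) slot (phi j)" for j
    have pos: "pos j \<in> message_positions k d" "slot (pos j) = phi j" if "j \<in> B" for j
      using that phiB slot
      by (auto simp: pos_def bij_betw_def f_inv_into_f image_subset_iff intro!: inv_into_into)
    have sym_ext_slot: "sym_ext k (\<lambda>p. z (slot p)) a b = sym_ext k (\<lambda>p. z' (slot p)) a b"
      if "\<And>i. i < mbr_size k d \<Longrightarrow> z i = z' i" "a < d" "b < d" for z z' :: "nat \<Rightarrow> 'a" and a b
      using that slot_lt[of "(min a b, max a b)"] by (auto simp: sym_ext_def message_positions_def)
    have local: "c (\<lambda>i\<in>{..<mbr_size k d}. z i) = c z" for z
      unfolding c_def
      by (intro restrict_ext eq_vecI) (auto intro!: sum.cong arg_cong2[where f = "(*)"] sym_ext_slot)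
    have shift: "\<exists>s. (\<forall>j\<in>B. s (phi j) = t j) \<and> (\<forall>z. c (\<lambda>i. z i + s i) = c z)"
      for t :: "nat \<Rightarrow> 'a"
    proof -
      \<comment> \<open>Since \<open>l < k\<close>, the natural subtraction \<open>k - l\<close> is
        exact.\<close>
      have "card (pos ` B) + card E \<le> k"
        using card_image_le[OF fin(1), of pos] B(2) E(2) assms(12) by linarith
      moreover have "pos ` B \<subseteq> message_positions k d" using pos(1) by blast
      moreover have "x i + y j \<noteq> 0" if "i \<in> E" "j < d" for i j using nz E(1) that by blast
      \<comment> \<open>The position \<open>pos j\<close> has to receive \<open>t j\<close>; as
        \<open>phi\<close> is injective on \<open>B\<close>, \<open>j\<close> is recovered from
        \<open>slot (pos j) = phi j\<close>.\<close>
      ultimately have "\<exists>v. (\<forall>p\<in>pos ` B. v p = t (inv_into B phi (slot p))) \<and>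
          (\<forall>i\<in>E. \<forall>b<d. (\<Sum>a<d. inverse (x i + y a) * sym_ext k v a b) = 0)"
        by (intro sym_ext_interpolation[OF y _ fin(2) assms(2)])
      then obtain v where v: "\<And>p. p \<in> pos ` B \<Longrightarrow> v p = t (inv_into B phi (slot p))"
        "\<And>i b. i \<in> E \<Longrightarrow> b < d \<Longrightarrow> (\<Sum>a<d. inverse (x i + y a) * sym_ext k v a b) = 0"
        by blast
      \<comment> \<open>The shift may change every variable, including random units and file units
        outside \<open>B\<close>; only its values at \<open>phi j\<close> for \<open>j\<close> in
        \<open>B\<close> are prescribed.\<close>
      define s where "s i = v (inv_into (message_positions k d) slot i)" for i
      have s_slot: "s (slot p) = v p" if "p \<in> message_positions k d" for p
        using that slot by (simp add: s_def bij_betw_def)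
      have "s (phi j) = t j" if "j \<in> B" for j
        using that pos s_slot[of "pos j"] v(1)[of "pos j"] inj by simp
      moreover have "c (\<lambda>i. z i + s i) = c z" for z
      proof -
        have ext: "sym_ext k (\<lambda>p. z (slot p) + s (slot p)) a b =
            sym_ext k (\<lambda>p. z (slot p)) a b + sym_ext k v a b" if "a < d" "b < d" for a b
          using that s_slot[of "(min a b, max a b)"]
          by (auto simp: sym_ext_def message_positions_def)
        have "(\<Sum>a<d. \<Psi> $$ (i, a) * sym_ext k (\<lambda>p. z (slot p) + s (slot p)) a b) =
            (\<Sum>a<d. \<Psi> $$ (i, a) * sym_ext k (\<lambda>p. z (slot p)) a b)"
          if "i \<in> E" "b < d" for i b
        proof -
          have "(\<Sum>a<d. \<Psi> $$ (i, a) * sym_ext k v a b) = 0"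
            using v(2)[OF that] E(1) that(1) \<Psi>_eq[of i] by (simp add: subset_iff)
          then show ?thesis using that(2) by (simp add: ext distrib_left sum.distrib)
        qed
        then show ?thesis unfolding c_def by (intro restrict_ext eq_vecI) auto
      qed
      ultimately show ?thesis by blast
    qed
    have "subfamily (node_content k d \<Psi> slot X) E = (\<lambda>\<omega>. c (\<lambda>i. X i \<omega>))"
      unfolding subfamily_def c_def
      by (intro ext restrict_ext node_content_eq[OF assms(2) \<Psi>]) (use E(1) in auto)
    moreover have "subfamily (file_unit phi X) B = (\<lambda>\<omega>. \<lambda>j\<in>B. X (phi j) \<omega>)"
      by (simp add: subfamily_def[abs_def] file_unit_def)
    ultimately show "mutual_info P (subfamily (file_unit phi X) B)
        (subfamily (node_content k d \<Psi> slot X) E) = 0"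
      using mutual_info_eq_0_shift[OF assms(6,7) mpos phiB fin(1) local shift] by simp
  qed
qed

end
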